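(* Let $n\ge 3$, $m=n-2$, and let $j',j,k,k'$ be integers with $1\le j'\le j<j+k\le j'+k'\le n$. Then \[ r_m(j',j'+k')-r_m(j,j+k)\ge 0, \] with equality if and only if (1) $j'=j$ and $k'=k$, or (2) $j'=j=1$, $k=1$ and $k'=2$, or (3) $j'=n-2$, $j=n-1$, $k=1$ and $k'=2$.
   Context: $r_m(a,b)$ denotes the resistance distance between vertices $a$ and $b$ in the straight linear 2-tree on $n=m+2$ vertices, i.e. the graph with vertex set $\{1,\dots,n\}$ and $\{a,b\}$ an edge iff $0<|a-b|\le 2$, with every edge a unit resistor; $r(a,b)=(\mathbf e_a-\mathbf e_b)^TL^{\dagger}(\mathbf e_a-\mathbf e_b)$ where $L^\dagger$ is the Moore–Penrose inverse of the graph Laplacian. *)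

theory Defs
  imports "Jordan_Normal_Form.Matrix"
begin

text \<open>
  A graph on the vertex set \<open>{1..n}\<close> is given by \<open>n\<close> and its set of edges, each edge being a
  two-element subset of \<open>{1..n}\<close>. Rows and columns of matrices are numbered from \<open>0\<close>, so
  vertex \<open>a\<close> has matrix index \<open>a - 1\<close>.
\<close>

definition linear_2_tree_edges :: "nat \<Rightarrow> nat set set" where
  "linear_2_tree_edges n =
    {{a, b} | a b. a \<in> {1..n} \<and> b \<in> {1..n} \<and> 0 < \<bar>int a - int b\<bar> \<and> \<bar>int a - int b\<bar> \<le> 2}"

definition graph_laplacian :: "nat \<Rightarrow> nat set set \<Rightarrow> real mat" where
  "graph_laplacian n E = mat n n (\<lambda>(i, j).
    if i = j then real (card {e \<in> E. Suc i \<in> e})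
    else if {Suc i, Suc j} \<in> E then - 1 else 0)"

text \<open>
  The four Penrose conditions; over the reals the conjugate transpose is the transpose.
\<close>

definition is_moore_penrose_inverse :: "real mat \<Rightarrow> real mat \<Rightarrow> bool" where
  "is_moore_penrose_inverse A X \<longleftrightarrow>
    X \<in> carrier_mat (dim_col A) (dim_row A) \<and>
    A * X * A = A \<and>
    X * A * X = X \<and>
    transpose_mat (A * X) = A * X \<and>
    transpose_mat (X * A) = X * A"

definition moore_penrose_inverse :: "real mat \<Rightarrow> real mat" where
  "moore_penrose_inverse A = (THE X. is_moore_penrose_inverse A X)"

definition resistance_distance :: "nat \<Rightarrow> nat set set \<Rightarrow> nat \<Rightarrow> nat \<Rightarrow> real" where
  "resistance_distance n E a b =
    (let v = unit_vec n (a - 1) - unit_vec n (b - 1)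
     in v \<bullet> (moore_penrose_inverse (graph_laplacian n E) *\<^sub>v v))"

text \<open>
  \<open>r m a b\<close> is only meaningful for vertices \<open>a, b \<in> {1..m + 2}\<close>; the index \<open>m\<close> is the number
  of triangles.
\<close>

definition r :: "nat \<Rightarrow> nat \<Rightarrow> nat \<Rightarrow> real" where
  "r m a b = resistance_distance (m + 2) (linear_2_tree_edges (m + 2)) a b"

end

theory Submission
  imports Defs "Jordan_Normal_Form.Determinant"
begin

text \<open>
  The difference \<open>r(a, b + 1) - r(a, b)\<close> equals \<open>w(b) + w(b + 1) - 2 w(a)\<close>, where \<open>w\<close> is the
  potential of a unit current entering at \<open>b + 1\<close> and leaving at \<open>b\<close>. This potential is harmonic to
  the left of \<open>b\<close>, and among these vertices only \<open>b - 1\<close> sees the high terminal \<open>b + 1\<close>, and it also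
  sees \<open>b\<close>; so the maximum principle bounds \<open>w\<close> there by the mean of the two terminal potentials,
  with equality only when \<open>b - 1\<close> has no further neighbours, that is, when \<open>b = 2\<close>. Moving the left
  end of the interval is the mirror image, and nested intervals are connected by such unit moves.
\<close>

section \<open>The Laplacian as a difference operator, and its energy\<close>

definition tree_nbrs :: "nat \<Rightarrow> nat \<Rightarrow> nat set" where
  "tree_nbrs n i = {j \<in> {1..n}. i \<noteq> j \<and> i \<le> j + 2 \<and> j \<le> i + 2}"

text \<open>Acts on functions of the vertex numbers, so that reflection and the maximum principle
  can be argued without matrices.\<close>

definition tree_lap :: "nat \<Rightarrow> (nat \<Rightarrow> real) \<Rightarrow> nat \<Rightarrow> real" where
  "tree_lap n f i = (\<Sum>j\<in>tree_nbrs n i. f i - f j)"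

lemma finite_tree_nbrs [simp]: "finite (tree_nbrs n i)"
  by (simp add: tree_nbrs_def)

lemma tree_lap_diff: "tree_lap n (\<lambda>i. f i - g i) i = tree_lap n f i - tree_lap n g i"
  by (simp add: tree_lap_def algebra_simps sum.distrib sum_subtractf)

text \<open>The reversal of \<open>{1..n}\<close> is an automorphism of the graph. It turns moves of
  the left end of an interval into moves of the right end.\<close>

lemma tree_lap_reflect:
  assumes "i \<in> {1..n}"
  shows "tree_lap n (\<lambda>i. f (n + 1 - i)) i = tree_lap n f (n + 1 - i)"
  unfolding tree_lap_def
  by (rule sum.reindex_bij_witness[where i = "\<lambda>j. n + 1 - j" and j = "\<lambda>j. n + 1 - j"])
     (use assms in \<open>auto simp: tree_nbrs_def\<close>)

text \<open>Exchanging the two ends of each edge in the double sum and adding gives squares. Each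
  edge is counted from both ends, hence the division by 2.\<close>

lemma tree_lap_energy:
  "(\<Sum>i\<in>{1..n}. f i * tree_lap n f i) = (\<Sum>i\<in>{1..n}. \<Sum>j\<in>tree_nbrs n i. (f i - f j)\<^sup>2) / 2"
proof -
  \<comment> \<open>Over all vertices the inner range no longer depends on \<open>i\<close>, so the
    sums can be swapped.\<close>
  have ind: "(\<Sum>j\<in>tree_nbrs n i. g j) = (\<Sum>j\<in>{1..n}. if j \<in> tree_nbrs n i then g j else 0)"
    for i and g :: "nat \<Rightarrow> real"
    by (subst sum.inter_filter[symmetric]) (auto simp: tree_nbrs_def intro!: sum.cong)
  have sym: "i \<in> {1..n} \<Longrightarrow> j \<in> {1..n} \<Longrightarrow> j \<in> tree_nbrs n i \<longleftrightarrow> i \<in> tree_nbrs n j" for i j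
    by (auto simp: tree_nbrs_def)
  have "(\<Sum>i\<in>{1..n}. f i * tree_lap n f i) = (\<Sum>i\<in>{1..n}. \<Sum>j\<in>tree_nbrs n i. f i * (f i - f j))"
    by (simp add: tree_lap_def sum_distrib_left)
  moreover have "\<dots> = (\<Sum>i\<in>{1..n}. \<Sum>j\<in>tree_nbrs n i. f j * (f j - f i))"
    unfolding ind by (subst sum.swap) (auto intro!: sum.cong simp: sym)
  moreover have "(\<Sum>i\<in>{1..n}. \<Sum>j\<in>tree_nbrs n i. f i * (f i - f j))
      + (\<Sum>i\<in>{1..n}. \<Sum>j\<in>tree_nbrs n i. f j * (f j - f i))
      = (\<Sum>i\<in>{1..n}. \<Sum>j\<in>tree_nbrs n i. (f i - f j)\<^sup>2)"
    unfolding sum.distrib[symmetric]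
    by (intro sum.cong refl) (simp add: power2_eq_square algebra_simps)
  ultimately show ?thesis by simp
qed

text \<open>A sum of squares that is not positive vanishes, so \<open>f\<close> agrees across every
  edge, and the path 1, 2, ..., n joins all vertices.\<close>

lemma constant_of_energy_nonpos:
  assumes "(\<Sum>i\<in>{1..n}. f i * tree_lap n f i) \<le> 0" and "i \<in> {1..n}"
  shows "f i = f 1"
proof -
  have "(\<Sum>i\<in>{1..n}. \<Sum>j\<in>tree_nbrs n i. (f i - f j)\<^sup>2) = 0"
    using assms(1) unfolding tree_lap_energy
    by (intro antisym sum_nonneg) auto
  hence "\<forall>i\<in>{1..n}. \<forall>j\<in>tree_nbrs n i. (f i - f j)\<^sup>2 = 0"
    by (simp add: sum_nonneg_eq_0_iff sum_nonneg)
  hence eq: "f i = f j" if "i \<in> {1..n}" "j \<in> tree_nbrs n i" for i j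
    using that by auto
  from assms(2) show ?thesis
  proof (induction i)
    case (Suc i)
    show ?case
    proof (cases "i = 0")
      case False
      hence "f (Suc i) = f i"
        using Suc.prems by (intro eq) (auto simp: tree_nbrs_def)
      with Suc False show ?thesis by auto
    qed simp
  qed simp
qed

section \<open>Dipole potentials and the maximum principle\<close>

text \<open>The energy of \<open>f\<close> is \<open>f d - f c\<close>. Were it not positive,
  \<open>f\<close> would be constant and its Laplacian at \<open>d\<close> would be 0 instead of
  1.\<close>

lemma dipole_potential_less:
  assumes "c \<in> {1..n}" "d \<in> {1..n}" "c \<noteq> d"
    and "\<And>i. i \<in> {1..n} \<Longrightarrow> tree_lap n f i = of_bool (i = d) - of_bool (i = c)"
  shows "f c < f d"
proof (rule ccontr)
  assume "\<not> f c < f d"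
  have "(\<Sum>i\<in>{1..n}. f i * tree_lap n f i)
      = (\<Sum>i\<in>{1..n}. (if i = d then f i else 0) - (if i = c then f i else 0))"
    by (intro sum.cong refl) (auto simp: assms(4))
  also have "\<dots> = f d - f c"
    using assms(1,2) by (simp add: sum_subtractf)
  finally have const: "f i = f 1" if "i \<in> {1..n}" for i
    using constant_of_energy_nonpos[of f n i] that \<open>\<not> f c < f d\<close> by simp
  have "f j = f d" if "j \<in> tree_nbrs n d" for j
    using const[of j] const[of d] that assms(2) by (auto simp: tree_nbrs_def)
  hence "tree_lap n f d = 0"
    by (simp add: tree_lap_def)
  with assms(2-4) show False by auto
qed

text \<open>The discarded terms are nonnegative. Applied at a maximiser \<open>i\<close>, this is
  the maximum principle.\<close>

lemma tree_lap_ge: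
  assumes "A \<subseteq> tree_nbrs n i" "\<And>j. j \<in> tree_nbrs n i - A \<Longrightarrow> f j \<le> f i"
  shows "(\<Sum>j\<in>A. f i - f j) \<le> tree_lap n f i"
  unfolding tree_lap_def by (rule sum_mono2) (use assms in auto)

text \<open>Let \<open>M\<close> be the maximum of \<open>f\<close> on \<open>{1..<b}\<close> and
  \<open>p\<close> its last maximiser. The distance from \<open>p\<close> to \<open>b\<close>
  decides which of the terminals \<open>b\<close> and \<open>b + 1\<close> are neighbours of
  \<open>p\<close>.\<close>

lemma harmonic_bound:
  assumes "b < n" "f b < f (b + 1)" "a \<in> {1..<b}"
    and harm: "\<And>i. i \<in> {1..<b} \<Longrightarrow> tree_lap n f i = 0"
  shows "2 * f a \<le> f b + f (b + 1)" and "2 * f a = f b + f (b + 1) \<longleftrightarrow> b = 2"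
proof -
  define M where "M = Max (f ` {1..<b})"
  have fM: "f i \<le> M" if "i \<in> {1..<b}" for i
    unfolding M_def using that by auto
  define p where "p = Max {i \<in> {1..<b}. f i = M}"
  have "M \<in> f ` {1..<b}"
    unfolding M_def using assms(3) by (intro Max_in) auto
  hence "p \<in> {i \<in> {1..<b}. f i = M}"
    unfolding p_def by (intro Max_in) auto
  hence p: "p \<in> {1..<b}" "f p = M" by auto
  have pmax: "f i < M" if "p < i" "i < b" for i
  proof -
    have "f i \<noteq> M"
    proof
      assume "f i = M"
      with that p have "i \<le> p" unfolding p_def by (intro Max_ge) auto
      with that show False by simp
    qed
    with fM[of i] that p show ?thesis by force
  qed
  consider "p + 3 \<le> b" | "p + 2 = b" | "p + 1 = b"
    using p by force
  hence M: "2 * M \<le> f b + f (b + 1) \<and> (2 * M = f b + f (b + 1) \<longrightarrow> b = 2)"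
  proof cases
    case 1
    \<comment> \<open>All neighbours of \<open>p\<close> lie left of \<open>b\<close> and
      \<open>p + 1\<close> is strictly lower, so the Laplacian at \<open>p\<close> would be
      positive: this case is impossible.\<close>
    have "(\<Sum>j\<in>{p + 1}. f p - f j) \<le> tree_lap n f p"
      by (rule tree_lap_ge) (use 1 p assms fM in \<open>auto simp: tree_nbrs_def\<close>)
    with harm[of p] pmax[of "p + 1"] p 1 show ?thesis by auto
  next
    case 2
    \<comment> \<open>Here \<open>p\<close> sees \<open>b\<close> but not \<open>b + 1\<close>. As
      \<open>p + 1\<close> is strictly lower, \<open>f b\<close> exceeds \<open>M\<close>, and
      \<open>f (b + 1)\<close> is higher still, so the bound is strict.\<close>
    have "(\<Sum>j\<in>{p + 1, b}. f p - f j) \<le> tree_lap n f p"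
    proof (rule tree_lap_ge)
      fix j assume "j \<in> tree_nbrs n p - {p + 1, b}"
      with 2 have "j \<in> {1..<b}" by (auto simp: tree_nbrs_def)
      thus "f j \<le> f p" using fM p by simp
    qed (use 2 p assms in \<open>auto simp: tree_nbrs_def\<close>)
    with harm[of p] pmax[of "p + 1"] p 2 assms(2) show ?thesis by auto
  next
    case 3
    \<comment> \<open>Now \<open>p\<close> sees both terminals. Taking \<open>A\<close> to be the
      terminals gives the bound; adding \<open>b - 2\<close> to \<open>A\<close> exploits
      equality.\<close>
    have ge: "(\<Sum>j\<in>A. f p - f j) \<le> 0"
      if "{b, b + 1} \<subseteq> A" "A \<subseteq> tree_nbrs n p" for A
    proof -
      have "(\<Sum>j\<in>A. f p - f j) \<le> tree_lap n f p"
      proof (rule tree_lap_ge)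
        fix j assume "j \<in> tree_nbrs n p - A"
        with that have "j \<noteq> b" "j \<noteq> b + 1" "j \<in> tree_nbrs n p" by auto
        with 3 have "j \<in> {1..<b}" by (auto simp: tree_nbrs_def)
        thus "f j \<le> f p" using fM p by simp
      qed (use that in auto)
      with harm p show ?thesis by simp
    qed
    have le: "2 * M \<le> f b + f (b + 1)"
      using ge[of "{b, b + 1}"] 3 p assms(1) by (auto simp: tree_nbrs_def)
    have "b = 2" if eq: "2 * M = f b + f (b + 1)"
    proof (rule ccontr)
      assume "b \<noteq> 2"
      with 3 p have "b \<ge> 3" by auto
      \<comment> \<open>Equality makes the neighbour \<open>q\<close> of \<open>p\<close> a
        maximiser too. But \<open>q\<close> sees only the lower terminal, so
        \<open>M \<le> f b\<close>, whereas equality and \<open>f b < f (b + 1)\<close> give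
        \<open>f b < M\<close>.\<close>
      define q where "q = b - 2"
      with \<open>b \<ge> 3\<close> have q: "b = q + 2" "q \<ge> 1" by auto
      have "M \<le> f q"
        using ge[of "{b, b + 1, q}"] 3 p assms(1) q eq by (auto simp: tree_nbrs_def)
      with fM[of q] q have fq: "f q = M" by simp
      have "(\<Sum>j\<in>{b}. f q - f j) \<le> tree_lap n f q"
      proof (rule tree_lap_ge)
        fix j assume "j \<in> tree_nbrs n q - {b}"
        with q have "j \<in> {1..<b}" by (auto simp: tree_nbrs_def)
        thus "f j \<le> f q" using fM fq by simp
      qed (use q assms in \<open>auto simp: tree_nbrs_def\<close>)
      with harm[of q] q fq eq assms(2) show False by auto
    qed
    with le show ?thesis by blast
  qed
  with fM[OF assms(3)] show "2 * f a \<le> f b + f (b + 1)" by simp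
  have "2 * f a = f b + f (b + 1)" if "b = 2"
  proof -
    \<comment> \<open>The neighbours of 1 are exactly the two terminals, so harmonicity at 1 is the
      equality.\<close>
    have "tree_nbrs n 1 = {2, 3}" using that assms(1) by (auto simp: tree_nbrs_def)
    with harm[of 1] that assms(3) show ?thesis by (simp add: tree_lap_def numeral_3_eq_3 numeral_2_eq_2)
  qed
  moreover have "2 * M = f b + f (b + 1)" if "2 * f a = f b + f (b + 1)"
    using that M fM[OF assms(3)] by linarith
  ultimately show "2 * f a = f b + f (b + 1) \<longleftrightarrow> b = 2"
    using M by blast
qed

section \<open>Uniqueness of the Moore-Penrose inverse\<close>

text \<open>Both \<open>A * X\<close> and \<open>A * Y\<close> are the orthogonal projection onto
  the range of \<open>A\<close>, hence equal; similarly \<open>X * A = Y * A\<close>. Then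
  \<open>X = Y * A * X = Y * A * Y = Y\<close>.\<close>

lemma moore_penrose_inverse_unique:
  assumes "is_moore_penrose_inverse A X" "is_moore_penrose_inverse A Y"
  shows "X = Y"
proof -
  define m n where "m = dim_row A" and "n = dim_col A"
  have A: "A \<in> carrier_mat m n" by (simp add: m_def n_def)
  have X: "X \<in> carrier_mat n m" and Y: "Y \<in> carrier_mat n m"
    using assms by (simp_all add: is_moore_penrose_inverse_def m_def n_def)
  have eqs: "A * X * A = A" "X * A * X = X" "(A * X)\<^sup>T = A * X" "(X * A)\<^sup>T = X * A"
    "A * Y * A = A" "Y * A * Y = Y" "(A * Y)\<^sup>T = A * Y" "(Y * A)\<^sup>T = Y * A"
    using assms by (simp_all add: is_moore_penrose_inverse_def)
  have AX: "A * X \<in> carrier_mat m m" and AY: "A * Y \<in> carrier_mat m m"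
    and XA: "X * A \<in> carrier_mat n n" and YA: "Y * A \<in> carrier_mat n n"
    using A X Y by auto
  have "A * X = (A * Y * A * X)\<^sup>T"
    by (simp add: eqs)
  also have "\<dots> = A * X * (A * Y)"
    by (simp only: assoc_mult_mat[OF AY A X] transpose_mult[OF AY AX] eqs(3,7))
  also have "\<dots> = A * X * A * Y"
    by (simp only: assoc_mult_mat[OF AX A Y])
  finally have left: "A * X = A * Y"
    by (simp add: eqs)
  have "X * A = (X * (A * Y * A))\<^sup>T"
    by (simp only: eqs)
  also have "\<dots> = ((X * A) * (Y * A))\<^sup>T"
    by (simp only: assoc_mult_mat[OF A Y A] assoc_mult_mat[OF X A YA])
  also have "\<dots> = Y * A * (X * A)"
    by (simp only: transpose_mult[OF XA YA] eqs)
  also have "\<dots> = Y * (A * X * A)"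
    by (simp only: assoc_mult_mat[OF Y A XA] assoc_mult_mat[OF A X A])
  finally have right: "X * A = Y * A"
    by (simp only: eqs)
  have "X = Y * A * X"
    by (simp only: right[symmetric] eqs)
  also have "\<dots> = Y * A * Y"
    by (simp only: assoc_mult_mat[OF Y A X] assoc_mult_mat[OF Y A Y] left)
  finally show ?thesis by (simp only: eqs)
qed

lemma moore_penrose_inverse_eqI:
  "is_moore_penrose_inverse A X \<Longrightarrow> moore_penrose_inverse A = X"
  unfolding moore_penrose_inverse_def
  by (rule the_equality) (auto intro: moore_penrose_inverse_unique)

section \<open>The Laplacian matrix\<close>

abbreviation tree_laplacian :: "nat \<Rightarrow> real mat" where
  "tree_laplacian n \<equiv> graph_laplacian n (linear_2_tree_edges n)"

lemma tree_laplacian_carrier [simp]: "tree_laplacian n \<in> carrier_mat n n"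
  by (simp add: graph_laplacian_def)

lemma edge_iff_tree_nbrs:
  assumes "i \<in> {1..n}"
  shows "{i, j} \<in> linear_2_tree_edges n \<longleftrightarrow> j \<in> tree_nbrs n i"
proof
  assume "j \<in> tree_nbrs n i"
  with assms have "i \<in> {1..n} \<and> j \<in> {1..n} \<and> 0 < \<bar>int i - int j\<bar> \<and> \<bar>int i - int j\<bar> \<le> 2"
    by (auto simp: tree_nbrs_def)
  thus "{i, j} \<in> linear_2_tree_edges n"
    unfolding linear_2_tree_edges_def by blast
qed (auto simp: linear_2_tree_edges_def tree_nbrs_def doubleton_eq_iff)

lemma card_incident_edges:
  assumes "i \<in> {1..n}"
  shows "card {e \<in> linear_2_tree_edges n. i \<in> e} = card (tree_nbrs n i)"
proof -
  have "{e \<in> linear_2_tree_edges n. i \<in> e} = (\<lambda>j. {i, j}) ` tree_nbrs n i"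
  proof (intro equalityI subsetI)
    fix e assume e: "e \<in> {e \<in> linear_2_tree_edges n. i \<in> e}"
    then obtain j where "e = {i, j}"
      unfolding linear_2_tree_edges_def by (auto simp: insert_commute)
    with e assms show "e \<in> (\<lambda>j. {i, j}) ` tree_nbrs n i"
      by (auto simp: edge_iff_tree_nbrs)
  qed (use assms in \<open>auto simp: edge_iff_tree_nbrs\<close>)
  moreover have "inj_on (\<lambda>j. {i, j}) (tree_nbrs n i)"
    by (auto simp: inj_on_def doubleton_eq_iff)
  ultimately show ?thesis by (simp add: card_image)
qed

text \<open>Links the matrix to the difference operator; \<open>k - 1\<close> and
  \<open>Suc i\<close> translate between indices from 0 and vertices from 1.\<close>

lemma tree_laplacian_mult_vec:
  assumes "i < n" "v \<in> carrier_vec n"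
  shows "(tree_laplacian n *\<^sub>v v) $ i = tree_lap n (\<lambda>k. v $ (k - 1)) (Suc i)"
proof -
  let ?N = "tree_nbrs n (Suc i)"
  let ?g = "\<lambda>k. v $ (k - 1)"
  have "Suc i \<notin> ?N" by (simp add: tree_nbrs_def)
  have "(tree_laplacian n *\<^sub>v v) $ i = (\<Sum>k<n. tree_laplacian n $$ (i, k) * v $ k)"
    using assms by (simp add: graph_laplacian_def scalar_prod_def lessThan_atLeast0)
  also have "\<dots> = (\<Sum>k<n. (if k = i then real (card ?N) * v $ k else 0)
      - (if Suc k \<in> ?N then ?g (Suc k) else 0))"
    using assms \<open>Suc i \<notin> ?N\<close>
    by (intro sum.cong refl) (auto simp: graph_laplacian_def edge_iff_tree_nbrs card_incident_edges)
  also have "\<dots> = real (card ?N) * v $ i - (\<Sum>k<n. if Suc k \<in> ?N then ?g (Suc k) else 0)"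
    using assms by (simp add: sum_subtractf)
  also have "(\<Sum>k<n. if Suc k \<in> ?N then ?g (Suc k) else 0)
      = (\<Sum>k\<in>{1..n}. if k \<in> ?N then ?g k else 0)"
    using sum.atLeast1_atMost_eq[of "\<lambda>k. if k \<in> ?N then ?g k else 0" n] by simp
  also have "\<dots> = (\<Sum>k\<in>?N. ?g k)"
    by (subst sum.inter_filter[symmetric]) (auto simp: tree_nbrs_def intro!: sum.cong)
  finally show ?thesis by (simp add: tree_lap_def sum_subtractf)
qed

lemma tree_laplacian_symmetric: "(tree_laplacian n)\<^sup>T = tree_laplacian n"
  by (intro eq_matI) (auto simp: graph_laplacian_def insert_commute)

section \<open>The pseudoinverse of the Laplacian\<close>

definition avg_mat :: "nat \<Rightarrow> real mat" where
  "avg_mat n = mat n n (\<lambda>_. 1 / real n)"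

lemma avg_mat_carrier [simp]: "avg_mat n \<in> carrier_mat n n"
  by (simp add: avg_mat_def)

lemma avg_mat_symmetric: "(avg_mat n)\<^sup>T = avg_mat n"
  by (intro eq_matI) (auto simp: avg_mat_def)

lemma avg_mat_idem: "avg_mat n * avg_mat n = avg_mat n"
  by (intro eq_matI) (auto simp: avg_mat_def scalar_prod_def)

lemma tree_laplacian_avg: "tree_laplacian n * avg_mat n = 0\<^sub>m n n"
proof (rule eq_matI)
  fix i c assume ic: "i < dim_row (0\<^sub>m n n)" "c < dim_col (0\<^sub>m n n)"
  hence "(tree_laplacian n * avg_mat n) $$ (i, c) = (tree_laplacian n *\<^sub>v col (avg_mat n) c) $ i"
    by (simp add: graph_laplacian_def avg_mat_def)
  also have "\<dots> = tree_lap n (\<lambda>k. col (avg_mat n) c $ (k - 1)) (Suc i)"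
    using ic col_carrier_vec[OF _ avg_mat_carrier, of c n]
    by (intro tree_laplacian_mult_vec) simp_all
  also have "\<dots> = 0"
    unfolding tree_lap_def using ic by (intro sum.neutral) (auto simp: tree_nbrs_def avg_mat_def)
  finally show "(tree_laplacian n * avg_mat n) $$ (i, c) = 0\<^sub>m n n $$ (i, c)"
    using ic by simp
qed (auto simp: graph_laplacian_def avg_mat_def)

lemma avg_tree_laplacian: "avg_mat n * tree_laplacian n = 0\<^sub>m n n"
proof -
  have "(tree_laplacian n * avg_mat n)\<^sup>T = avg_mat n * tree_laplacian n"
    by (subst transpose_mult[of _ n n _ n]) (auto simp: tree_laplacian_symmetric avg_mat_symmetric)
  thus ?thesis by (simp add: tree_laplacian_avg)
qed

text \<open>Applying \<open>J\<close> to \<open>L v + J v = 0\<close> gives \<open>J v = 0\<close>,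
  since \<open>J L = 0\<close> and \<open>J J = J\<close>; hence \<open>L v = 0\<close>. So
  \<open>v\<close> is constant, and \<open>J v = 0\<close> says that its mean is 0.\<close>

lemma laplacian_plus_avg_inj:
  assumes v: "v \<in> carrier_vec n" and zero: "(tree_laplacian n + avg_mat n) *\<^sub>v v = 0\<^sub>v n"
  shows "v = 0\<^sub>v n"
proof -
  let ?L = "tree_laplacian n" and ?J = "avg_mat n"
  have L: "?L \<in> carrier_mat n n" and J: "?J \<in> carrier_mat n n" by simp_all
  have sum0: "?L *\<^sub>v v + ?J *\<^sub>v v = 0\<^sub>v n"
    using zero v by (simp add: add_mult_distrib_mat_vec[OF L J])
  have "?J *\<^sub>v v = ?J *\<^sub>v (?L *\<^sub>v v) + ?J *\<^sub>v (?J *\<^sub>v v)"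
    unfolding assoc_mult_mat_vec[OF J L v, symmetric] assoc_mult_mat_vec[OF J J v, symmetric]
      avg_tree_laplacian avg_mat_idem
    using v by (intro eq_vecI) (auto simp: avg_mat_def)
  also have "\<dots> = ?J *\<^sub>v (?L *\<^sub>v v + ?J *\<^sub>v v)"
    by (rule mult_add_distrib_mat_vec[symmetric, OF J])
      (auto intro: mult_mat_vec_carrier[OF L v] mult_mat_vec_carrier[OF J v])
  also have "\<dots> = 0\<^sub>v n"
    unfolding sum0 by (intro eq_vecI) (auto simp: avg_mat_def scalar_prod_def)
  finally have Jv: "?J *\<^sub>v v = 0\<^sub>v n" .
  with sum0 have Lv: "?L *\<^sub>v v = 0\<^sub>v n"
    using mult_mat_vec_carrier[OF L v] by simp
  define f where "f = (\<lambda>k. v $ (k - 1))"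
  have "tree_lap n f i = 0" if "i \<in> {1..n}" for i
  proof -
    from that obtain k where "i = Suc k" "k < n" by (cases i) auto
    with tree_laplacian_mult_vec[of k n v] v show ?thesis
      unfolding Lv f_def by simp
  qed
  hence const: "f i = f 1" if "i \<in> {1..n}" for i
    using that by (intro constant_of_energy_nonpos[of f n]) auto
  have vc: "v $ i = f 1" if "i < n" for i
    using const[of "Suc i"] that by (simp add: f_def)
  show ?thesis
  proof (rule eq_vecI)
    fix i assume i: "i < dim_vec (0\<^sub>v n)"
    have "(?J *\<^sub>v v) $ i = f 1"
      using i v vc by (simp add: avg_mat_def scalar_prod_def)
    with Jv i vc show "v $ i = 0\<^sub>v n $ i" by simp
  qed (use v in auto)
qed

text \<open>
  The kernel of the Laplacian \<open>L\<close> is spanned by the all-ones vector, onto which \<open>J = avg_mat n\<close>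
  projects. Hence \<open>L + J\<close> is invertible, and the Moore-Penrose inverse of \<open>L\<close> is
  \<open>(L + J)\<^sup>-\<^sup>1 - J\<close>.
\<close>

lemma tree_laplacian_pseudoinverse:
  obtains X where "X \<in> carrier_mat n n" "X\<^sup>T = X"
    "tree_laplacian n * X = 1\<^sub>m n - avg_mat n"
    "moore_penrose_inverse (tree_laplacian n) = X"
proof -
  let ?L = "tree_laplacian n" and ?J = "avg_mat n"
  let ?K = "?L + ?J"
  have L: "?L \<in> carrier_mat n n" and J: "?J \<in> carrier_mat n n" and K: "?K \<in> carrier_mat n n"
    by simp_all
  have "det ?K \<noteq> 0"
    using laplacian_plus_avg_inj by (auto simp: det_0_iff_vec_prod_zero[OF K])
  from det_non_zero_imp_unit[OF K this, of "()"]
  obtain P where P: "P \<in> carrier_mat n n" and PK: "P * ?K = 1\<^sub>m n" and KP: "?K * P = 1\<^sub>m n"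
    by (auto simp: Units_def ring_mat_simps)
  have PT: "P\<^sup>T \<in> carrier_mat n n" using P by simp
  have KT: "?K\<^sup>T = ?K"
    by (simp add: transpose_add[OF L J] tree_laplacian_symmetric avg_mat_symmetric)
  \<comment> \<open>As \<open>?K\<close> is symmetric, the transpose of \<open>P\<close> is a left
    inverse of it and so equals the right inverse \<open>P\<close>.\<close>
  have "P\<^sup>T * ?K = (?K * P)\<^sup>T"
    by (simp only: transpose_mult[OF K P] KT)
  also have "\<dots> = 1\<^sub>m n" by (simp only: KP transpose_one)
  finally have "P\<^sup>T = P"
    using assoc_mult_mat[OF PT K P] KP P PT by simp
  \<comment> \<open>On constant vectors \<open>?K\<close> is the identity, and hence so is its
    inverse \<open>P\<close>.\<close>
  have KJ: "?K * ?J = ?J"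
    by (simp add: add_mult_distrib_mat[OF L J J] tree_laplacian_avg avg_mat_idem left_add_zero_mat[OF J])
  have JK: "?J * ?K = ?J"
    by (simp add: mult_add_distrib_mat[OF J L J] avg_tree_laplacian avg_mat_idem left_add_zero_mat[OF J])
  have PJ: "P * ?J = ?J"
    using assoc_mult_mat[OF P K J] by (simp add: KJ PK left_mult_one_mat[OF J])
  have JP: "?J * P = ?J"
    using assoc_mult_mat[OF J K P] by (simp add: JK KP right_mult_one_mat[OF J])
  have LK: "?L = ?K - ?J"
    by (intro eq_matI) (auto simp: avg_mat_def graph_laplacian_def)
  have LP: "?L * P = 1\<^sub>m n - ?J"
    by (subst LK) (simp only: minus_mult_distrib_mat[OF K J P] KP JP)
  have PL: "P * ?L = 1\<^sub>m n - ?J"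
    by (subst LK) (simp only: mult_minus_distrib_mat[OF P K J] PK PJ)
  define X where "X = P - ?J"
  have X: "X \<in> carrier_mat n n" by (simp add: X_def minus_carrier_mat)
  have diff0: "B - 0\<^sub>m n n = B" if "B \<in> carrier_mat n n" for B :: "real mat"
    using that by (intro eq_matI) auto
  have Q: "1\<^sub>m n - ?J \<in> carrier_mat n n" by (simp add: minus_carrier_mat)
  have LX: "?L * X = 1\<^sub>m n - ?J"
    by (simp only: X_def mult_minus_distrib_mat[OF L P J] LP tree_laplacian_avg diff0[OF Q])
  have XL: "X * ?L = 1\<^sub>m n - ?J"
    by (simp only: X_def minus_mult_distrib_mat[OF P J L] PL avg_tree_laplacian diff0[OF Q])
  have one: "1\<^sub>m n \<in> carrier_mat n n" by simp
  have QT: "(1\<^sub>m n - ?J)\<^sup>T = 1\<^sub>m n - ?J"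
    by (simp only: transpose_minus[OF one J] transpose_one avg_mat_symmetric)
  have JX: "?J * X = 0\<^sub>m n n"
    unfolding X_def mult_minus_distrib_mat[OF J P J] JP avg_mat_idem
    by (intro eq_matI) (auto simp: avg_mat_def)
  have "is_moore_penrose_inverse ?L X"
    unfolding is_moore_penrose_inverse_def
  proof (intro conjI)
    show "X \<in> carrier_mat (dim_col ?L) (dim_row ?L)"
      using X by (simp add: graph_laplacian_def)
    show "?L * X * ?L = ?L"
      by (simp only: LX minus_mult_distrib_mat[OF one J L] avg_tree_laplacian
          left_mult_one_mat[OF L] diff0[OF L])
    show "X * ?L * X = X"
      by (simp only: XL minus_mult_distrib_mat[OF one J X] JX left_mult_one_mat[OF X] diff0[OF X])
  qed (simp_all only: LX XL QT)
  hence "moore_penrose_inverse ?L = X" by (rule moore_penrose_inverse_eqI)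
  moreover have "X\<^sup>T = X"
    unfolding X_def transpose_minus[OF P J] avg_mat_symmetric \<open>P\<^sup>T = P\<close> ..
  ultimately show thesis using that X LX by blast
qed

section \<open>Resistance through a Green function\<close>

abbreviation tree_resistance :: "nat \<Rightarrow> nat \<Rightarrow> nat \<Rightarrow> real" where
  "tree_resistance n \<equiv> resistance_distance n (linear_2_tree_edges n)"

text \<open>\<open>G\<close> consists of the entries of the pseudoinverse. Its column
  \<open>c\<close> is the potential of a unit source at \<open>c\<close> drained uniformly over all
  vertices, which explains \<open>1 / real n\<close>.\<close>

lemma tree_resistance_green:
  obtains G :: "nat \<Rightarrow> nat \<Rightarrow> real" where
    "\<And>a b. a \<in> {1..n} \<Longrightarrow> b \<in> {1..n} \<Longrightarrow> G a b = G b a"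
    "\<And>a b. a \<in> {1..n} \<Longrightarrow> b \<in> {1..n} \<Longrightarrow>
      tree_resistance n a b = G a a + G b b - 2 * G a b"
    "\<And>i c. i \<in> {1..n} \<Longrightarrow> c \<in> {1..n} \<Longrightarrow>
      tree_lap n (\<lambda>i. G i c) i = of_bool (i = c) - 1 / real n"
proof -
  obtain X where X: "X \<in> carrier_mat n n" "X\<^sup>T = X"
    "tree_laplacian n * X = 1\<^sub>m n - avg_mat n"
    "moore_penrose_inverse (tree_laplacian n) = X"
    by (rule tree_laplacian_pseudoinverse)
  define G where "G a b = X $$ (a - 1, b - 1)" for a b
  have sym: "G a b = G b a" if "a \<in> {1..n}" "b \<in> {1..n}" for a b
  proof -
    have "X\<^sup>T $$ (a - 1, b - 1) = X $$ (b - 1, a - 1)"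
      using that X(1) by (intro index_transpose_mat) auto
    thus ?thesis unfolding G_def X(2) .
  qed
  show thesis
  proof (rule that[of G, OF sym])
    fix a b assume ab: "a \<in> {1..n}" "b \<in> {1..n}"
    define u w :: "real vec" where "u = unit_vec n (a - 1)" and "w = unit_vec n (b - 1)"
    have uw: "u \<in> carrier_vec n" "w \<in> carrier_vec n" by (simp_all add: u_def w_def)
    have entry: "unit_vec n i \<bullet> (X *\<^sub>v unit_vec n j) = X $$ (i, j)" if "i < n" "j < n" for i j
      using that X(1) by (simp add: scalar_prod_left_unit scalar_prod_right_unit)
    have "tree_resistance n a b = (u - w) \<bullet> (X *\<^sub>v (u - w))"
      by (simp add: resistance_distance_def X(4) Let_def u_def w_def)
    also have "X *\<^sub>v (u - w) = X *\<^sub>v u - X *\<^sub>v w"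
      using X(1) uw by (rule mult_minus_distrib_mat_vec)
    also have "(u - w) \<bullet> \<dots> = u \<bullet> (X *\<^sub>v u) - u \<bullet> (X *\<^sub>v w) - (w \<bullet> (X *\<^sub>v u) - w \<bullet> (X *\<^sub>v w))"
      using X(1) uw
      by (simp add: minus_scalar_prod_distrib[of _ n] scalar_prod_minus_distrib[of _ n]
          mult_mat_vec_carrier[of _ n n] minus_carrier_vec)
    also have "\<dots> = G a a + G b b - 2 * G a b"
    proof -
      have idx: "a - 1 < n" "b - 1 < n" using ab by auto
      show ?thesis
        using sym[OF ab]
        unfolding u_def w_def entry[OF idx(1) idx(1)] entry[OF idx(1) idx(2)]
          entry[OF idx(2) idx(1)] entry[OF idx(2) idx(2)] G_def by simp
    qed
    finally show "tree_resistance n a b = G a a + G b b - 2 * G a b" .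
  next
    fix i c assume ic: "i \<in> {1..n}" "c \<in> {1..n}"
    have "tree_lap n (\<lambda>i. G i c) i = tree_lap n (\<lambda>k. col X (c - 1) $ (k - 1)) i"
      unfolding tree_lap_def using ic X(1) by (intro sum.cong refl) (auto simp: tree_nbrs_def G_def)
    also have "\<dots> = (tree_laplacian n *\<^sub>v col X (c - 1)) $ (i - 1)"
      using ic X(1) by (subst tree_laplacian_mult_vec) auto
    also have "\<dots> = (tree_laplacian n * X) $$ (i - 1, c - 1)"
    proof -
      have "i - 1 < dim_row (tree_laplacian n)" "c - 1 < dim_col X"
        using ic X(1) by (auto simp: graph_laplacian_def)
      thus ?thesis by (simp only: index_mult_mat_vec index_mult_mat)
    qed
    also have "\<dots> = of_bool (i = c) - 1 / real n"
      unfolding X(3) using ic by (auto simp: avg_mat_def)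
    finally show "tree_lap n (\<lambda>i. G i c) i = of_bool (i = c) - 1 / real n" .
  qed
qed

text \<open>In the difference of the columns \<open>d\<close> and \<open>c\<close> of
  \<open>G\<close> the uniform drains cancel, leaving a unit dipole. The terms \<open>G a a\<close>
  cancel too, and by symmetry \<open>w c + w d = G d d - G c c\<close>.\<close>

lemma tree_resistance_diff:
  assumes "a \<in> {1..n}" "c \<in> {1..n}" "d \<in> {1..n}" "c \<noteq> d"
  obtains w where "w c < w d"
    "\<And>i. i \<in> {1..n} \<Longrightarrow> tree_lap n w i = of_bool (i = d) - of_bool (i = c)"
    "tree_resistance n a d - tree_resistance n a c = w c + w d - 2 * w a"
proof -
  obtain G :: "nat \<Rightarrow> nat \<Rightarrow> real" where
    sym: "\<And>a b. a \<in> {1..n} \<Longrightarrow> b \<in> {1..n} \<Longrightarrow> G a b = G b a" and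
    res: "\<And>a b. a \<in> {1..n} \<Longrightarrow> b \<in> {1..n} \<Longrightarrow>
      tree_resistance n a b = G a a + G b b - 2 * G a b" and
    lapG: "\<And>i c. i \<in> {1..n} \<Longrightarrow> c \<in> {1..n} \<Longrightarrow>
      tree_lap n (\<lambda>i. G i c) i = of_bool (i = c) - 1 / real n"
    by (rule tree_resistance_green[of n]) blast
  define w where "w = (\<lambda>i. G i d - G i c)"
  have lapw: "tree_lap n w i = of_bool (i = d) - of_bool (i = c)" if "i \<in> {1..n}" for i
    using that assms by (simp add: w_def tree_lap_diff lapG)
  show thesis
  proof (rule that[of w, OF _ lapw])
    show "w c < w d"
      using assms lapw by (intro dipole_potential_less[of c n d]) auto
    show "tree_resistance n a d - tree_resistance n a c = w c + w d - 2 * w a"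
      using assms sym[of c d] by (simp add: res w_def)
  qed
qed

section \<open>Moving one endpoint by one\<close>

text \<open>The dipole has its terminals at \<open>b\<close> and \<open>b + 1\<close>, so its
  potential is harmonic on \<open>{1..<b}\<close>, where \<open>a\<close> lies.\<close>

lemma tree_resistance_step_right:
  assumes "1 \<le> a" "a < b" "b < n"
  shows "tree_resistance n a b \<le> tree_resistance n a (b + 1)"
    and "tree_resistance n a b = tree_resistance n a (b + 1) \<longleftrightarrow> b = 2"
proof -
  obtain w where w: "w b < w (b + 1)"
    "\<And>i. i \<in> {1..n} \<Longrightarrow> tree_lap n w i = of_bool (i = b + 1) - of_bool (i = b)"
    "tree_resistance n a (b + 1) - tree_resistance n a b = w b + w (b + 1) - 2 * w a"
    using assms by (elim tree_resistance_diff[of a n b "b + 1", rotated -1]) auto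
  have "tree_lap n w i = 0" if "i \<in> {1..<b}" for i
    using that assms w(2)[of i] by auto
  from harmonic_bound[OF assms(3) w(1) _ this, of a] assms(1,2) w(3)
  show "tree_resistance n a b \<le> tree_resistance n a (b + 1)"
    and "tree_resistance n a b = tree_resistance n a (b + 1) \<longleftrightarrow> b = 2"
    by auto
qed

lemma tree_resistance_commute:
  assumes "a \<in> {1..n}" "b \<in> {1..n}"
  shows "tree_resistance n a b = tree_resistance n b a"
proof -
  obtain G :: "nat \<Rightarrow> nat \<Rightarrow> real" where
    "\<And>a b. a \<in> {1..n} \<Longrightarrow> b \<in> {1..n} \<Longrightarrow> G a b = G b a"
    "\<And>a b. a \<in> {1..n} \<Longrightarrow> b \<in> {1..n} \<Longrightarrow>
      tree_resistance n a b = G a a + G b b - 2 * G a b"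
    by (rule tree_resistance_green[of n]) blast
  with assms show ?thesis by simp
qed

lemma tree_resistance_step_left:
  assumes "1 \<le> a" "a + 1 < b" "b \<le> n"
  shows "tree_resistance n (a + 1) b \<le> tree_resistance n a b"
    and "tree_resistance n (a + 1) b = tree_resistance n a b \<longleftrightarrow> a + 2 = n"
proof -
  obtain w where w: "w (a + 1) < w a"
    "\<And>i. i \<in> {1..n} \<Longrightarrow> tree_lap n w i = of_bool (i = a) - of_bool (i = a + 1)"
    "tree_resistance n b a - tree_resistance n b (a + 1) = w (a + 1) + w a - 2 * w b"
    using assms by (elim tree_resistance_diff[of b n "a + 1" a, rotated -1]) auto
  \<comment> \<open>Reflection puts the low terminal \<open>a + 1\<close> at \<open>n - a\<close>
    and the high terminal \<open>a\<close> at \<open>n - a + 1\<close>, as the harmonic bound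
    requires; its exceptional case becomes \<open>n - a = 2\<close>.\<close>
  define v where "v = (\<lambda>i. w (n + 1 - i))"
  have idx: "n + 1 - (n - a) = a + 1" "n + 1 - (n - a + 1) = a" "n + 1 - (n + 1 - b) = b"
    using assms by auto
  have harm: "tree_lap n v i = 0" if "i \<in> {1..<n - a}" for i
  proof -
    have i: "i \<in> {1..n}" "n + 1 - i \<in> {1..n}" "n + 1 - i \<noteq> a" "n + 1 - i \<noteq> a + 1"
      using that assms by auto
    show ?thesis
      unfolding v_def tree_lap_reflect[OF i(1)] w(2)[OF i(2)] using i(3,4) by simp
  qed
  have lt: "v (n - a) < v (n - a + 1)"
    unfolding v_def idx by (rule w(1))
  have "n + 1 - b \<in> {1..<n - a}" "n - a < n"
    using assms by auto
  note bound = harmonic_bound[OF this(2) lt this(1) harm]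
  have "2 * w b \<le> w (a + 1) + w a" "2 * w b = w (a + 1) + w a \<longleftrightarrow> n - a = 2"
    using bound unfolding v_def idx by auto
  moreover have "tree_resistance n b a = tree_resistance n a b"
    "tree_resistance n b (a + 1) = tree_resistance n (a + 1) b"
    using assms by (auto intro!: tree_resistance_commute)
  ultimately show "tree_resistance n (a + 1) b \<le> tree_resistance n a b"
    and "tree_resistance n (a + 1) b = tree_resistance n a b \<longleftrightarrow> a + 2 = n"
    using w(3) assms by auto
qed

section \<open>Nested intervals\<close>

text \<open>Only the unit move from 2 to 3 preserves the resistance, so a chain of moves does so
  only if it is empty or that single move.\<close>

lemma tree_resistance_mono_right:
  assumes "1 \<le> a" "a < b" "b \<le> c" "c \<le> n"
  shows "tree_resistance n a b \<le> tree_resistance n a c \<and>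
    (tree_resistance n a b = tree_resistance n a c \<longleftrightarrow> b = c \<or> b = 2 \<and> c = 3)"
  using assms(3,4)
proof (induction c rule: dec_induct)
  case (step c)
  with assms tree_resistance_step_right[of a c n] show ?case by auto
qed simp

text \<open>Downward induction on \<open>a\<close>; the only unit move without gain is from
  \<open>n - 1\<close> to \<open>n - 2\<close>.\<close>

lemma tree_resistance_mono_left:
  assumes "1 \<le> a" "a \<le> b" "b < c" "c \<le> n"
  shows "tree_resistance n b c \<le> tree_resistance n a c \<and>
    (tree_resistance n b c = tree_resistance n a c \<longleftrightarrow> a = b \<or> a + 2 = n \<and> b + 1 = n)"
  using assms(2,1)
proof (induction a rule: inc_induct)
  case (step a)
  with assms tree_resistance_step_left[of a c n] show ?case by auto
qed simp

theorem theorem6p1: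
  fixes n m j' j k k' :: nat
  assumes "n \<ge> 3" and "m = n - 2"
    and "1 \<le> j'" and "j' \<le> j" and "j < j + k" and "j + k \<le> j' + k'" and "j' + k' \<le> n"
  shows "r m j' (j' + k') - r m j (j + k) \<ge> 0 \<and>
    (r m j' (j' + k') - r m j (j + k) = 0 \<longleftrightarrow>
      (j' = j \<and> k' = k) \<or>
      (j' = 1 \<and> j = 1 \<and> k = 1 \<and> k' = 2) \<or>
      (j' = n - 2 \<and> j = n - 1 \<and> k = 1 \<and> k' = 2))"
proof -
  have r: "r m = tree_resistance n"
  proof -
    have "m + 2 = n" using assms(1,2) by simp
    thus ?thesis by (simp only: r_def fun_eq_iff) simp
  qed
  \<comment> \<open>The pair \<open>j\<close>, \<open>j' + k'\<close> is the intermediate stage: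
    first the right end moves out, then the left. Total equality means equality in both
    stages.\<close>
  have right: "tree_resistance n j (j + k) \<le> tree_resistance n j (j' + k') \<and>
    (tree_resistance n j (j + k) = tree_resistance n j (j' + k') \<longleftrightarrow>
      j + k = j' + k' \<or> j + k = 2 \<and> j' + k' = 3)"
    using assms by (intro tree_resistance_mono_right) auto
  have left: "tree_resistance n j (j' + k') \<le> tree_resistance n j' (j' + k') \<and>
    (tree_resistance n j (j' + k') = tree_resistance n j' (j' + k') \<longleftrightarrow>
      j' = j \<or> j' + 2 = n \<and> j + 1 = n)"
    using assms by (intro tree_resistance_mono_left) auto
  \<comment> \<open>The two exceptional moves cannot occur together: \<open>j + k = 2\<close> forces
    \<open>j = 1\<close>, and then \<open>j + 1 = n\<close> contradicts
    \<open>n \<ge> 3\<close>.\<close>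
  have cases: "(j + k = j' + k' \<or> j + k = 2 \<and> j' + k' = 3) \<and>
      (j' = j \<or> j' + 2 = n \<and> j + 1 = n) \<longleftrightarrow>
    (j' = j \<and> k' = k) \<or>
    (j' = 1 \<and> j = 1 \<and> k = 1 \<and> k' = 2) \<or>
    (j' = n - 2 \<and> j = n - 1 \<and> k = 1 \<and> k' = 2)"
    using assms by auto
  have "z - x \<ge> 0 \<and> (z - x = 0 \<longleftrightarrow> x = y \<and> y = z)" if "x \<le> y" "y \<le> z" for x y z :: real
    using that by auto
  from this[OF conjunct1[OF right] conjunct1[OF left]] show ?thesis
    unfolding r conjunct2[OF right] conjunct2[OF left] cases .
qed

end
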